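(* Let $\phi(t)=\frac{t}{(1-e^{-t})^2}-\frac{1}{1-e^{-t}}$ for $t>0$. Then for every complex $s$ with $\Re(s)>0$, $$(s-1)\zeta(s)=\frac{1}{\Gamma(s)}\int_{0}^{\infty}\phi(t)\,e^{-t}\,t^{s-1}\,dt.$$
   Context: $\zeta$ denotes the Riemann zeta function, analytically continued to $\mathbb{C}\setminus\{1\}$, with a simple pole of residue $1$ at $s=1$. At $s=1$ the expression $(s-1)\zeta(s)$ is understood as the value $1$ of its analytic extension. *)

theory Defs
  imports "HOL-Complex_Analysis.Complex_Analysis"
begin

(* Analytic continuation of the Dirichlet series to the plane without 1. Since that
   domain is connected, the two conditions determine the function there uniquely;
   the value at the pole 1 is arbitrary. *)
definition riemann_zeta :: "complex \<Rightarrow> complex" where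
  "riemann_zeta = (SOME f. f holomorphic_on (- {1}) \<and>
     (\<forall>s. Re s > 1 \<longrightarrow> f s = (\<Sum>n. 1 / of_nat (Suc n) powr s)))"

(* Only meaningful for t > 0. *)
definition phi :: "real \<Rightarrow> real" where
  "phi t = t / (1 - exp (- t))\<^sup>2 - 1 / (1 - exp (- t))"

end

theory Submission imports Defs
begin

text \<open>
  Put \<open>g(t) = \<phi>(t) e\<^sup>-\<^sup>t\<close> and \<open>F(s) = \<integral>\<^sub>0\<^sup>\<infinity> g(t) t\<^sup>s\<^sup>-\<^sup>1 dt\<close>. Expanding in powers of \<open>e\<^sup>-\<^sup>t\<close> gives
  \<open>g(t) = \<Sum>\<^sub>m (m t - 1) exp(-m t)\<close>, summed over \<open>m \<ge> 1\<close>. The Mellin transform of the \<open>m\<close>-th term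
  is \<open>(\<Gamma>(s+1) - \<Gamma>(s)) / m\<^sup>s = (s - 1) \<Gamma>(s) / m\<^sup>s\<close>, and for \<open>Re s > 1\<close> the series may be
  integrated term by term, so that \<open>F(s) = (s - 1) \<Gamma>(s) \<zeta>(s)\<close>
  (\<open>mellin_zeta_kernel_eq_Dirichlet\<close>).

  To reach \<open>Re s > 0\<close> it must first be known that the Dirichlet series has a continuation to the
  plane without 1, since \<open>riemann_zeta\<close> is chosen among such continuations. The same
  integral provides one: \<open>F / \<Gamma>\<close> extends to an entire function
  (\<open>mellin_zeta_kernel_entire\<close>), and dividing that function by \<open>s - 1\<close> continues the series. For
  the extension, the integral is cut at 1. The part over \<open>[1, \<infinity>)\<close> is entire because \<open>g\<close> decays
  exponentially (\<open>mellin_tail_entire\<close>). Near 0, \<open>g\<close> has a Taylor series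
  \<open>\<Sum>\<^sub>n a\<^sub>n t\<^sup>n\<close> of radius larger than 1 (\<open>zeta_kernel_power_series\<close>), so the part over \<open>(0, 1)\<close>
  equals \<open>\<Sum>\<^sub>n a\<^sub>n / (s + n)\<close> (\<open>mellin_unit_interval_sums\<close>). Its poles are cancelled by
  the zeros of \<open>1/\<Gamma>\<close> (\<open>rGamma_partial_fractions_entire\<close>).

  The identity theorem on the connected set \<open>\<complex> - {1}\<close> then carries
  \<open>(s - 1) \<zeta>(s) = F(s)/\<Gamma>(s)\<close> from \<open>Re s > 1\<close> to \<open>Re s > 0\<close>. At \<open>s = 1\<close> the integral is
  elementary: \<open>g\<close> is the derivative of \<open>-t / (exp(t) - 1)\<close>, which runs from \<open>-1\<close> to \<open>0\<close>.
\<close>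

section \<open>Size of the kernel and convergence of its Mellin transform\<close>

definition zeta_kernel :: "real \<Rightarrow> real" where
  "zeta_kernel t = phi t * exp (- t)"

lemma borel_measurable_zeta_kernel [measurable]: "zeta_kernel \<in> borel_measurable borel"
  unfolding zeta_kernel_def [abs_def] phi_def [abs_def] by measurable

text \<open>
  With \<open>u = 1 - exp(-t)\<close> one has \<open>\<phi>(t) = (t - u) / u\<^sup>2\<close>. The double zero of the denominator is
  compensated by \<open>t - u \<le> u t\<close> and \<open>t \<le> u (1 + t)\<close>, both of which restate
  \<open>1 + t \<le> exp(t)\<close>. The resulting bound is a sum of Gamma integrands for every exponent, so it
  serves near 0 and near infinity alike.
\<close>
lemma zeta_kernel_bounds:
  assumes "t > 0"
  shows "0 \<le> zeta_kernel t" and "zeta_kernel t \<le> (1 + t) * exp (- t)"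
proof -
  define u where "u = 1 - exp (- t)"
  have u0: "u > 0" using assms by (simp add: u_def)
  have "exp (- t) \<le> 1 / (1 + t)"
    using assms exp_ge_add_one_self[of t] by (simp add: exp_minus field_simps)
  hence lo: "t / (1 + t) \<le> u"
    using assms by (simp add: u_def field_simps)
  have hi: "u \<le> t"
    using exp_ge_add_one_self[of "-t"] by (simp add: u_def)
  have phi: "phi t = (t - u) / u\<^sup>2"
    using u0 by (simp add: phi_def flip: u_def) (simp add: field_simps power2_eq_square)
  have "0 \<le> phi t" using hi by (simp add: phi)
  thus "0 \<le> zeta_kernel t" by (simp add: zeta_kernel_def)
  have tu: "t \<le> u * (1 + t)" using lo assms by (simp add: field_simps)
  have "t - u \<le> u * t" using tu by (simp add: algebra_simps)
  also have "\<dots> \<le> u * (u * (1 + t))" using tu u0 by (intro mult_left_mono) auto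
  finally have "phi t \<le> 1 + t"
    using u0 by (simp add: phi field_simps power2_eq_square)
  thus "zeta_kernel t \<le> (1 + t) * exp (- t)" by (simp add: zeta_kernel_def)
qed

lemma Gamma_integral_scaled:
  fixes z :: complex
  assumes z: "Re z > 0" and c: "c > 0"
  shows "has_bochner_integral lborel
           (\<lambda>t. indicator {0<..} t *\<^sub>R (of_real t powr (z - 1) * of_real (exp (- (c * t)))))
           (Gamma z / of_real c powr z)"
proof -
  define f :: "real \<Rightarrow> complex"
    where "f = (\<lambda>t. indicator {0<..} t *\<^sub>R (of_real t powr (z - 1) * of_real (exp (- t))))"
  have f_eq: "f = (\<lambda>t. indicator {0<..} t *\<^sub>R (of_real t powr (z - 1) / of_real (exp t)))"
    by (auto simp: f_def exp_minus field_simps)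
  have meas: "f \<in> borel_measurable lborel"
    unfolding f_def by measurable
  have si: "set_integrable lborel {0<..} (\<lambda>t. complex_of_real t powr (z - 1) / of_real (exp t))"
    using absolutely_integrable_Gamma_integral'[OF z] meas
    unfolding set_integrable_def f_eq by (simp add: integrable_completion)
  have "has_bochner_integral lborel f (Gamma z)"
    using set_borel_integral_eq_integral(2)[OF si] si Gamma_integral_complex'[OF z]
    by (auto simp: has_bochner_integral_iff f_eq set_integrable_def set_lebesgue_integral_def
             dest: integral_unique)
  hence "has_bochner_integral lborel (\<lambda>t. f (0 + c * t)) (Gamma z /\<^sub>R \<bar>c\<bar>)"
    using c by (subst (asm) lborel_has_bochner_integral_real_affine_iff[of c _ _ 0]) auto
  hence "has_bochner_integral lborel (\<lambda>t. f (0 + c * t) * inverse (of_real c powr (z - 1)))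
           (Gamma z /\<^sub>R \<bar>c\<bar> * inverse (of_real c powr (z - 1)))"
    by (intro has_bochner_integral_mult_left)
  also have "(\<lambda>t. f (0 + c * t) * inverse (of_real c powr (z - 1))) =
      (\<lambda>t. indicator {0<..} t *\<^sub>R (of_real t powr (z - 1) * of_real (exp (- (c * t)))))"
    using c by (auto simp: f_def fun_eq_iff indicator_def powr_times_real zero_less_mult_iff)
  also have "Gamma z /\<^sub>R \<bar>c\<bar> * inverse (of_real c powr (z - 1)) = Gamma z / of_real c powr z"
    using c by (simp add: powr_diff scaleR_conv_of_real field_simps)
  finally show ?thesis .
qed

text \<open>Majorants of the complex integrands have the real exponent \<open>Re s - 1\<close>.\<close>
lemma Gamma_integral_scaled_real:
  fixes a :: real
  assumes a: "a > 0" and c: "c > 0"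
  shows "has_bochner_integral lborel
           (\<lambda>t. indicator {0<..} t * (t powr (a - 1) * exp (- (c * t))))
           (Gamma a / c powr a)"
proof -
  have "has_bochner_integral lborel
     (\<lambda>t. Re (indicator {0<..} t *\<^sub>R (of_real t powr (of_real a - 1) * of_real (exp (- (c * t))))))
     (Re (Gamma (of_real a) / of_real c powr of_real a))"
    using has_bochner_integral_bounded_linear[OF bounded_linear_Re Gamma_integral_scaled[of "of_real a" c]] a c
    by simp
  also have "Gamma (complex_of_real a) / of_real c powr of_real a = of_real (Gamma a / c powr a)"
    using c by (simp add: Gamma_complex_of_real powr_of_real)
  also have "(\<lambda>t. Re (indicator {0<..} t *\<^sub>R (of_real t powr (of_real a - 1) * of_real (exp (- (c * t))))))
     = (\<lambda>t. indicator {0<..} t * (t powr (a - 1) * exp (- (c * t))))"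
  proof
    fix t :: real
    have "of_real t powr (of_real a - 1) = complex_of_real (t powr (a - 1))" if "t > 0"
      using that powr_of_real[of t "a - 1"] by simp
    thus "Re (indicator {0<..} t *\<^sub>R (of_real t powr (of_real a - 1) * of_real (exp (- (c * t)))))
       = indicator {0<..} t * (t powr (a - 1) * exp (- (c * t)))"
      by (cases "t > 0") auto
  qed
  finally show ?thesis by simp
qed

text \<open>
  For \<open>c = 1\<close> this integrand dominates the kernel; for \<open>c = m\<close> it dominates the \<open>m\<close>-th term of the
  series of the kernel, and the exact value makes the sum over \<open>m\<close> a convergent \<open>p\<close>-series.
\<close>
lemma integrable_mellin_bound:
  fixes a c :: real
  assumes a: "a > 0" and c: "c > 0"
  shows "set_integrable lborel {0<..} (\<lambda>t. (1 + c * t) * exp (- (c * t)) * t powr (a - 1))"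
    and "(LINT t:{0<..}|lborel. (1 + c * t) * exp (- (c * t)) * t powr (a - 1)) = (1 + a) * Gamma a / c powr a"
proof -
  have "has_bochner_integral lborel
     (\<lambda>t. indicator {0<..} t * (t powr (a - 1) * exp (- (c * t))) +
          c * (indicator {0<..} t * (t powr ((a + 1) - 1) * exp (- (c * t)))))
     (Gamma a / c powr a + c * (Gamma (a + 1) / c powr (a + 1)))"
    using assms by (intro has_bochner_integral_add has_bochner_integral_mult_right
        Gamma_integral_scaled_real) auto
  also have "a \<notin> \<int>\<^sub>\<le>\<^sub>0" using a by (auto elim!: nonpos_Ints_cases)
  hence "Gamma a / c powr a + c * (Gamma (a + 1) / c powr (a + 1)) = (1 + a) * Gamma a / c powr a"
    using assms Gamma_plus1[of a] by (simp add: powr_add add.commute field_simps)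
  also have "(\<lambda>t. indicator {0<..} t * (t powr (a - 1) * exp (- (c * t))) +
          c * (indicator {0<..} t * (t powr ((a + 1) - 1) * exp (- (c * t))))) =
      (\<lambda>t. indicator {0<..} t *\<^sub>R ((1 + c * t) * exp (- (c * t)) * t powr (a - 1)))"
    by (auto simp: fun_eq_iff indicator_def powr_diff field_simps)
  finally have *: "has_bochner_integral lborel
      (\<lambda>t. indicator {0<..} t *\<^sub>R ((1 + c * t) * exp (- (c * t)) * t powr (a - 1)))
      ((1 + a) * Gamma a / c powr a)" .
  show "set_integrable lborel {0<..} (\<lambda>t. (1 + c * t) * exp (- (c * t)) * t powr (a - 1))"
    and "(LINT t:{0<..}|lborel. (1 + c * t) * exp (- (c * t)) * t powr (a - 1)) = (1 + a) * Gamma a / c powr a"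
    using * by (auto simp: has_bochner_integral_iff set_integrable_def set_lebesgue_integral_def)
qed

lemma norm_mellin_zeta_kernel_le:
  assumes "t > 0"
  shows "norm (complex_of_real (zeta_kernel t) * of_real t powr (s - 1)) \<le> (1 + t) * exp (- t) * t powr (Re s - 1)"
proof -
  have "norm (complex_of_real (zeta_kernel t) * of_real t powr (s - 1)) = zeta_kernel t * t powr (Re s - 1)"
    using zeta_kernel_bounds(1)[OF assms] assms by (simp add: norm_mult norm_powr_real_powr)
  also have "\<dots> \<le> (1 + t) * exp (- t) * t powr (Re s - 1)"
    by (intro mult_right_mono zeta_kernel_bounds assms) simp
  finally show ?thesis .
qed

lemma integrable_mellin_zeta_kernel:
  assumes "Re s > 0"
  shows "set_integrable lborel {0<..} (\<lambda>t. complex_of_real (zeta_kernel t) * of_real t powr (s - 1))"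
proof (rule set_integrable_bound)
  show "set_integrable lborel {0<..} (\<lambda>t. (1 + 1 * t) * exp (- (1 * t)) * t powr (Re s - 1))"
    using assms by (intro integrable_mellin_bound) auto
  show "set_borel_measurable lborel {0<..} (\<lambda>t. complex_of_real (zeta_kernel t) * of_real t powr (s - 1))"
    unfolding set_borel_measurable_def by measurable
  show "AE t in lborel. t \<in> {0<..} \<longrightarrow> norm (complex_of_real (zeta_kernel t) * of_real t powr (s - 1))
          \<le> norm ((1 + 1 * t) * exp (- (1 * t)) * t powr (Re s - 1))"
    using norm_mellin_zeta_kernel_le[of _ s] by (intro AE_I2 impI) (simp add: abs_mult)
qed

section \<open>The Dirichlet series on the half-plane of absolute convergence\<close>

text \<open>
  The expansions of \<open>x / (1 - x)\<^sup>2\<close> and \<open>x / (1 - x)\<close> at \<open>x = exp(-t)\<close>. The second series majorises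
  the first and justifies exchanging sum and integral.
\<close>
lemma zeta_kernel_sums:
  assumes "t > 0"
  shows "(\<lambda>n. (real (Suc n) * t - 1) * exp (- (real (Suc n) * t))) sums zeta_kernel t"
    and "summable (\<lambda>n. (1 + real (Suc n) * t) * exp (- (real (Suc n) * t)))"
proof -
  define x where "x = exp (- t)"
  have x: "norm x < 1" "x \<noteq> 1" using assms by (auto simp: x_def)
  have e: "exp (- (real (Suc n) * t)) = x * x ^ n" for n
    by (simp add: x_def algebra_simps flip: exp_of_nat_mult exp_add)
  have "(\<lambda>n. t * x * (of_nat (Suc n) * x ^ n) - x * x ^ n) sums (t * x * (1 / (1 - x)^2) - x * (1 / (1 - x)))"
    by (intro sums_diff sums_mult geometric_deriv_sums geometric_sums x)
  also have "t * x * (1 / (1 - x)^2) - x * (1 / (1 - x)) = zeta_kernel t"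
    by (simp add: zeta_kernel_def phi_def flip: x_def) (simp add: algebra_simps)
  finally show "(\<lambda>n. (real (Suc n) * t - 1) * exp (- (real (Suc n) * t))) sums zeta_kernel t"
    unfolding e by (simp add: algebra_simps)
  have "summable (\<lambda>n. t * x * (of_nat (Suc n) * x ^ n) + x * x ^ n)"
    by (intro summable_add summable_mult sums_summable[OF geometric_deriv_sums] summable_geometric x)
  thus "summable (\<lambda>n. (1 + real (Suc n) * t) * exp (- (real (Suc n) * t)))"
    unfolding e by (simp add: algebra_simps)
qed

text \<open>
  Term by term, \<open>m \<Gamma>(s+1) / m\<^sup>s\<^sup>+\<^sup>1 - \<Gamma>(s) / m\<^sup>s = (s - 1) \<Gamma>(s) / m\<^sup>s\<close>. The \<open>L\<^sup>1\<close> norms of the terms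
  are at most \<open>(1 + \<sigma>) \<Gamma>(\<sigma>) / m\<^sup>\<sigma>\<close> with \<open>\<sigma> = Re s\<close>, which is summable exactly because \<open>\<sigma> > 1\<close>.
\<close>
lemma mellin_zeta_kernel_eq_Dirichlet:
  assumes s: "Re s > 1"
  shows "(LINT t:{0<..}|lborel. complex_of_real (zeta_kernel t) * of_real t powr (s - 1)) =
         (s - 1) * Gamma s * (\<Sum>n. 1 / of_nat (Suc n) powr s)"
proof -
  define f :: "nat \<Rightarrow> real \<Rightarrow> complex" where
    "f n t = indicator {0<..} t *\<^sub>R (complex_of_real ((real (Suc n) * t - 1) * exp (- (real (Suc n) * t))) *
             of_real t powr (s - 1))" for n t
  have bi: "has_bochner_integral lborel (f n) ((s - 1) * Gamma s * (1 / of_nat (Suc n) powr s))" for n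
  proof -
    define m where "m = real (Suc n)"
    have m: "m > 0" by (simp add: m_def)
    have "has_bochner_integral lborel
      (\<lambda>t. of_real m * (indicator {0<..} t *\<^sub>R (of_real t powr ((s + 1) - 1) * of_real (exp (- (m * t)))))
          - indicator {0<..} t *\<^sub>R (of_real t powr (s - 1) * of_real (exp (- (m * t)))))
      (of_real m * (Gamma (s + 1) / of_real m powr (s + 1)) - Gamma s / of_real m powr s)"
      using s m by (intro has_bochner_integral_diff has_bochner_integral_mult_right
          Gamma_integral_scaled) auto
    also have "s \<notin> \<int>\<^sub>\<le>\<^sub>0" using s by (auto elim!: nonpos_Ints_cases)
    hence "of_real m * (Gamma (s + 1) / of_real m powr (s + 1)) - Gamma s / of_real m powr s
        = (s - 1) * Gamma s * (1 / of_real m powr s)"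
      using m Gamma_plus1[of s] by (simp add: powr_add add.commute field_simps)
    also have "complex_of_real m = of_nat (Suc n)" by (simp add: m_def)
    also have "(\<lambda>t. of_nat (Suc n) * (indicator {0<..} t *\<^sub>R (of_real t powr ((s + 1) - 1) * of_real (exp (- (m * t)))))
          - indicator {0<..} t *\<^sub>R (of_real t powr (s - 1) * of_real (exp (- (m * t))))) = f n"
    proof
      fix t :: real
      have "of_real t powr s = of_real t * of_real t powr (s - 1)" if "t > 0"
        using that by (simp add: powr_diff)
      thus "of_nat (Suc n) * (indicator {0<..} t *\<^sub>R (of_real t powr ((s + 1) - 1) * of_real (exp (- (m * t)))))
          - indicator {0<..} t *\<^sub>R (of_real t powr (s - 1) * of_real (exp (- (m * t)))) = f n t"
        by (cases "t > 0") (simp_all add: f_def m_def algebra_simps)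
    qed
    finally show ?thesis .
  qed
  have norm_f: "norm (f n t) \<le> indicator {0<..} t *\<^sub>R
      ((1 + real (Suc n) * t) * exp (- (real (Suc n) * t)) * t powr (Re s - 1))" for n t
  proof (cases "t > 0")
    case True
    have "\<bar>real (Suc n) * t - 1\<bar> \<le> 1 + real (Suc n) * t"
      using True by (simp add: abs_le_iff)
    thus ?thesis using True
      by (simp add: f_def norm_mult norm_powr_real_powr abs_mult mult_right_mono
          del: of_real_mult of_real_diff of_nat_Suc)
  qed (simp add: f_def)
  have int: "integrable lborel (f n)" for n
    using bi[of n] has_bochner_integral_iff by blast
  have norm_int: "(\<integral>t. norm (f n t) \<partial>lborel) \<le> (1 + Re s) * Gamma (Re s) / real (Suc n) powr Re s" for n
  proof -
    have "(\<integral>t. norm (f n t) \<partial>lborel) \<le> 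
       (LINT t:{0<..}|lborel. (1 + real (Suc n) * t) * exp (- (real (Suc n) * t)) * t powr (Re s - 1))"
      unfolding set_lebesgue_integral_def
      using integrable_mellin_bound(1)[of "Re s" "real (Suc n)"] s
      by (intro integral_mono integrable_norm int norm_f) (auto simp: set_integrable_def)
    thus ?thesis using s integrable_mellin_bound(2)[of "Re s" "real (Suc n)"] by simp
  qed
  have "summable (\<lambda>n. real (Suc n) powr (- Re s))"
    using s summable_real_powr_iff[of "- Re s"] by (subst summable_Suc_iff) auto
  hence "summable (\<lambda>n. (1 + Re s) * Gamma (Re s) * real (Suc n) powr (- Re s))"
    by (rule summable_mult)
  hence sum_norm: "summable (\<lambda>n. \<integral>t. norm (f n t) \<partial>lborel)"
    by (rule summable_comparison_test') (use norm_int in \<open>auto simp: powr_minus field_simps\<close>)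
  have sum_pt: "summable (\<lambda>n. norm (f n t))" for t
  proof (cases "t > 0")
    case True
    have "summable (\<lambda>n. (1 + real (Suc n) * t) * exp (- (real (Suc n) * t)) * t powr (Re s - 1))"
      by (intro summable_mult2 zeta_kernel_sums True)
    thus ?thesis
      by (rule summable_comparison_test') (use norm_f[of _ t] True in auto)
  qed (auto simp: f_def)
  have "(\<lambda>n. integral\<^sup>L lborel (f n)) sums (\<integral>t. (\<Sum>n. f n t) \<partial>lborel)"
    by (intro sums_integral int sum_norm AE_I2 sum_pt)
  also have "(\<lambda>n. integral\<^sup>L lborel (f n)) = (\<lambda>n. (s - 1) * Gamma s * (1 / of_nat (Suc n) powr s))"
    by (intro ext has_bochner_integral_integral_eq bi)
  also have "(\<lambda>t. \<Sum>n. f n t) = (\<lambda>t. indicator {0<..} t *\<^sub>R (complex_of_real (zeta_kernel t) * of_real t powr (s - 1)))"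
  proof
    fix t :: real
    show "(\<Sum>n. f n t) = indicator {0<..} t *\<^sub>R (complex_of_real (zeta_kernel t) * of_real t powr (s - 1))"
    proof (cases "t > 0")
      case True
      have "(\<lambda>n. f n t) sums (complex_of_real (zeta_kernel t) * of_real t powr (s - 1))"
        using True unfolding f_def
        by (simp del: of_real_mult of_real_diff of_nat_Suc)
           (intro sums_mult2 sums_of_real zeta_kernel_sums)
      thus ?thesis using True by (simp add: sums_iff)
    qed (auto simp: f_def)
  qed
  finally have sm: "(\<lambda>n. (s - 1) * Gamma s * (1 / of_nat (Suc n) powr s)) sums
     (LINT t:{0<..}|lborel. complex_of_real (zeta_kernel t) * of_real t powr (s - 1))"
    by (simp add: set_lebesgue_integral_def)
  have "Gamma s \<noteq> 0" using s by (subst Gamma_eq_zero_iff) (auto elim!: nonpos_Ints_cases)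
  moreover have "s \<noteq> 1" using s by auto
  ultimately have "summable (\<lambda>n. 1 / of_nat (Suc n) powr s)"
    using sums_summable[OF sm] by (subst (asm) summable_cmult_iff) auto
  from suminf_mult[OF this, of "(s - 1) * Gamma s"] sums_unique[OF sm] show ?thesis
    by (simp only:)
qed

section \<open>The kernel as a derivative and its value at the pole\<close>

text \<open>This form shows the kernel as minus the derivative of \<open>t / (exp(t) - 1)\<close>.\<close>
lemma zeta_kernel_eq:
  assumes "t > 0"
  shows "zeta_kernel t = (t * exp t - (exp t - 1)) / (exp t - 1)\<^sup>2"
proof -
  define X where "X = exp t"
  have X: "X > 1" using assms by (simp add: X_def)
  hence X': "X \<noteq> 0" "X - 1 \<noteq> 0" by auto
  have "1 - 1 / X = (X - 1) / X" using X' by (simp add: diff_divide_distrib)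
  hence "zeta_kernel t = (t / ((X - 1) / X)\<^sup>2 - 1 / ((X - 1) / X)) / X"
    by (simp add: zeta_kernel_def phi_def exp_minus X_def divide_inverse)
  also have "\<dots> = (t * X - (X - 1)) / (X - 1)\<^sup>2"
    using X' by (simp add: divide_simps) (simp add: algebra_simps power2_eq_square)
  finally show ?thesis by (simp add: X_def)
qed

lemma zeta_kernel_primitive:
  assumes "t > 0"
  shows "((\<lambda>t. - (t / (exp t - 1))) has_field_derivative zeta_kernel t) (at t)"
proof -
  have "((\<lambda>t. t / (exp t - 1)) has_field_derivative
          (1 * (exp t - 1) - t * exp t) / ((exp t - 1) * (exp t - 1))) (at t)"
    using assms by (auto intro!: derivative_eq_intros)
  from DERIV_minus[OF this] show ?thesis
    unfolding zeta_kernel_eq[OF assms]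
    by (simp add: power2_eq_square minus_divide_left del: divide_minus_left)
qed

lemma continuous_on_zeta_kernel: "continuous_on {0<..} zeta_kernel"
  unfolding zeta_kernel_def phi_def by (intro continuous_intros) auto

lemma integral_zeta_kernel: "(LINT t:{0<..}|lborel. zeta_kernel t) = 1"
proof -
  have "(LBINT t=ereal 0..\<infinity>. zeta_kernel t) = 0 - (-1)"
  proof (rule interval_integral_FTC_nonneg(2))
    show "((\<lambda>t. - (t / (exp t - 1))) has_real_derivative zeta_kernel t) (at t)" if "ereal 0 < ereal t" for t
      using that by (intro zeta_kernel_primitive) auto
    show "isCont zeta_kernel t" if "ereal 0 < ereal t" for t
      using that continuous_on_zeta_kernel by (auto simp: continuous_on_eq_continuous_at)
    show "AE t in lborel. ereal 0 < ereal t \<longrightarrow> ereal t < \<infinity> \<longrightarrow> 0 \<le> zeta_kernel t"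
      using zeta_kernel_bounds(1) by (intro AE_I2) auto
    have "((\<lambda>t::real. - (t / (exp t - 1))) \<longlongrightarrow> -1) (at_right 0)"
      by real_asymp
    thus "(((\<lambda>t. - (t / (exp t - 1))) \<circ> real_of_ereal) \<longlongrightarrow> -1) (at_right (ereal 0))"
      by (simp add: ereal_tendsto_simps)
    have "((\<lambda>t::real. - (t / (exp t - 1))) \<longlongrightarrow> 0) at_top"
      by real_asymp
    thus "(((\<lambda>t. - (t / (exp t - 1))) \<circ> real_of_ereal) \<longlongrightarrow> 0) (at_left \<infinity>)"
      by (simp add: ereal_tendsto_simps)
  qed auto
  thus ?thesis by (simp add: interval_integral_to_infinity_eq)
qed

section \<open>Entire continuation of the normalised Mellin transform\<close>

text \<open>
  The function \<open>z / (exp(z) - 1)\<close> has a removable singularity at 0 and no other singularity of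
  modulus below \<open>2\<pi>\<close>, and the kernel is minus its derivative. The radius 2 is a convenient value
  between 1 and \<open>2\<pi>\<close>; what matters is that it exceeds 1, so that the coefficients are absolutely
  summable.
\<close>
lemma zeta_kernel_power_series:
  obtains a :: "nat \<Rightarrow> complex"
  where "summable (\<lambda>n. norm (a n))"
    and "\<And>t. 0 < t \<Longrightarrow> t < 1 \<Longrightarrow> (\<lambda>n. a n * of_real t ^ n) sums of_real (zeta_kernel t)"
proof -
  \<comment> \<open>The removable singularity is filled in for \<open>(exp(z) - 1) / z\<close>, as a difference quotient,
    because this function does not vanish on the disc and can then be inverted.\<close>
  define w :: "complex \<Rightarrow> complex"
    where "w = (\<lambda>z. if z = 0 then deriv exp 0 else (exp z - exp 0) / (z - 0))"
  have w_holo: "w holomorphic_on ball 0 2"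
    unfolding w_def by (intro pole_lemma_open holomorphic_intros) auto
  have exp_ne: "exp z \<noteq> 1" if "z \<noteq> 0" "norm z < 2" for z :: complex
  proof
    assume "exp z = 1"
    then obtain n :: int where n: "Re z = 0" "Im z = of_int (2 * n) * pi"
      unfolding exp_eq_1 by blast
    have "n \<noteq> 0" using n that(1) by (auto simp: complex_eq_iff)
    hence "2 * pi * 1 \<le> 2 * pi * \<bar>of_int n\<bar>" by (intro mult_left_mono) auto
    also have "\<dots> = \<bar>Im z\<bar>" using n by (simp add: abs_mult)
    also have "\<dots> \<le> norm z" by (rule abs_Im_le_cmod)
    finally show False using that(2) pi_gt3 by linarith
  qed
  have w_ne: "w z \<noteq> 0" if "z \<in> ball 0 2" for z
    using exp_ne[of z] that by (auto simp: w_def DERIV_imp_deriv[OF DERIV_exp])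
  define b where "b = (\<lambda>z. 1 / w z)"
  have b_holo: "b holomorphic_on ball 0 2"
    unfolding b_def using w_ne by (intro holomorphic_intros w_holo) auto
  have db: "deriv b (of_real t) = - of_real (zeta_kernel t)" if t: "0 < t" "t < 2" for t :: real
  proof -
    let ?z = "complex_of_real t"
    have ne: "exp ?z \<noteq> 1" using exp_ne[of ?z] t by auto
    have D: "((\<lambda>z. z / (exp z - 1)) has_field_derivative
            (1 * (exp ?z - 1) - ?z * exp ?z) / ((exp ?z - 1) * (exp ?z - 1))) (at ?z)"
      using ne by (auto intro!: derivative_eq_intros)
    have "(b has_field_derivative
            (1 * (exp ?z - 1) - ?z * exp ?z) / ((exp ?z - 1) * (exp ?z - 1))) (at ?z)"
      by (rule has_field_derivative_transform_within_open[OF D, of "- {0}"])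
         (use t in \<open>auto simp: b_def w_def\<close>)
    hence "deriv b ?z = (1 * (exp ?z - 1) - ?z * exp ?z) / ((exp ?z - 1) * (exp ?z - 1))"
      by (rule DERIV_imp_deriv)
    also have "\<dots> = - of_real (zeta_kernel t)"
      using ne unfolding zeta_kernel_eq[OF t(1)] 
      by (simp add: power2_eq_square minus_divide_left del: divide_minus_left flip: exp_of_real)
    finally show ?thesis .
  qed
  define a where "a n = - ((deriv ^^ n) (deriv b) 0 / fact n)" for n
  have ser: "(\<lambda>n. a n * z ^ n) sums (- deriv b z)" if "norm z < 2" for z
    using sums_minus[OF holomorphic_power_series[of "deriv b" 0 2 z]] that b_holo
    by (auto simp: a_def intro!: holomorphic_deriv)
  have "summable (\<lambda>n. norm (a n * 1 ^ n))"
    by (rule powser_insidea[where x = "3/2"]) (use ser[of "3/2"] in \<open>auto simp: sums_iff\<close>)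
  moreover have "(\<lambda>n. a n * of_real t ^ n) sums of_real (zeta_kernel t)" if "0 < t" "t < 1" for t
    using ser[of "of_real t"] db[of t] that by auto
  ultimately show ?thesis by (intro that) auto
qed

lemma integral_power_Ioo:
  fixes z :: complex
  assumes z: "Re z > 0"
  shows "set_integrable lborel {0<..<1} (\<lambda>t. of_real t powr (z - 1))"
    and "(LINT t:{0<..<1}|lborel. of_real t powr (z - 1)) = 1 / z"
    and "(LINT t:{0<..<1}|lborel. norm (of_real t powr (z - 1))) = 1 / Re z"
proof -
  \<comment> \<open>Stated for all exponents \<open>u\<close>: taken at \<open>Re z\<close> it also gives the integral of the norm.\<close>
  have FTC: "((\<lambda>t. complex_of_real t powr (u - 1)) has_integral (1 / u)) {0<..<1}" if u: "Re u > 0" for u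
  proof -
    have "((\<lambda>t. complex_of_real t powr (u - 1)) has_integral
            (of_real 1 powr u / u - of_real 0 powr u / u)) {0..1}"
    proof (rule fundamental_theorem_of_calculus_interior)
      show "continuous_on {0..1} (\<lambda>t. complex_of_real t powr u / u)"
        using u by (intro continuous_intros) auto
      show "((\<lambda>t. complex_of_real t powr u / u) has_vector_derivative of_real t powr (u - 1)) (at t)"
        if "t \<in> {0<..<1}" for t
        using that u
        by (intro has_vector_derivative_real_field) (auto intro!: derivative_eq_intros)
    qed auto
    thus ?thesis by (simp add: has_integral_Icc_iff_Ioo)
  qed
  have norm_eq: "norm (complex_of_real t powr (z - 1)) = t powr (Re z - 1)" if "t \<in> {0<..<1}" for t
    using that by (simp add: norm_powr_real_powr)
  have norm_int: "((\<lambda>t. norm (complex_of_real t powr (z - 1))) has_integral (1 / Re z)) {0<..<1}"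
  proof -
    have "((\<lambda>t. Re (complex_of_real t powr (of_real (Re z) - 1))) has_integral Re (1 / of_real (Re z))) {0<..<1}"
      using has_integral_linear[OF FTC[of "of_real (Re z)"] bounded_linear_Re] z by (simp add: o_def)
    also have "Re (1 / of_real (Re z)) = 1 / Re z" using Re_complex_of_real[of "1 / Re z"] by simp
    finally show ?thesis
    proof (rule has_integral_eq[rotated])
      fix t :: real assume t: "t \<in> {0<..<1}"
      show "Re (complex_of_real t powr (of_real (Re z) - 1)) = norm (complex_of_real t powr (z - 1))"
        using t powr_of_real[of t "Re z - 1"] by (simp add: norm_eq)
    qed
  qed
  have "(\<lambda>t. complex_of_real t powr (z - 1)) absolutely_integrable_on {0<..<1}"
    using FTC[OF z] norm_int by (auto simp: absolutely_integrable_on_def integrable_on_def)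
  thus si: "set_integrable lborel {0<..<1} (\<lambda>t. of_real t powr (z - 1))"
    by (simp add: set_integrable_def integrable_completion)
  show "(LINT t:{0<..<1}|lborel. of_real t powr (z - 1)) = 1 / z"
    using set_borel_integral_eq_integral(2)[OF si] FTC[OF z] by (simp add: integral_unique)
  show "(LINT t:{0<..<1}|lborel. norm (of_real t powr (z - 1))) = 1 / Re z"
    using set_borel_integral_eq_integral(2)[OF set_integrable_norm[OF si]] norm_int
    by (simp add: integral_unique)
qed

text \<open>
  Termwise integration of a power series against \<open>t\<^sup>s\<^sup>-\<^sup>1\<close>. Absolute summability of the
  coefficients bounds both the \<open>L\<^sup>1\<close> norms, by \<open>|a\<^sub>n| / Re s\<close>, and the terms at each point.
\<close>
lemma mellin_unit_interval_sums:
  fixes a :: "nat \<Rightarrow> complex"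
  assumes summ: "summable (\<lambda>n. norm (a n))"
    and ser: "\<And>t. 0 < t \<Longrightarrow> t < 1 \<Longrightarrow> (\<lambda>n. a n * of_real t ^ n) sums g t"
    and s: "Re s > 0"
  shows "(\<lambda>n. a n / (s + of_nat n)) sums (LINT t:{0<..<1}|lborel. g t * of_real t powr (s - 1))"
proof -
  define f :: "nat \<Rightarrow> real \<Rightarrow> complex" where
    "f n t = indicator {0<..<1} t *\<^sub>R (a n * of_real t powr (s + of_nat n - 1))" for n t
  have f_eq: "f n t = indicator {0<..<1} t *\<^sub>R (a n * of_real t ^ n * of_real t powr (s - 1))" for n t
  proof (cases "t \<in> {0<..<1}")
    case True
    have "of_real t powr (s + of_nat n - 1) = of_real t powr ((s - 1) + of_nat n)"
      by (simp add: algebra_simps)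
    also have "\<dots> = of_real t powr (s - 1) * of_real t ^ n"
      using True by (simp add: powr_add powr_nat')
    finally show ?thesis by (simp add: f_def)
  qed (simp add: f_def)
  have int: "integrable lborel (f n)" and val: "integral\<^sup>L lborel (f n) = a n / (s + of_nat n)" 
    and nval: "(\<integral>t. norm (f n t) \<partial>lborel) = norm (a n) / (Re s + n)" for n
  proof -
    note * = integral_power_Ioo[of "s + of_nat n"]
    have si: "set_integrable lborel {0<..<1} (\<lambda>t. a n * of_real t powr (s + of_nat n - 1))"
      using *(1) s by auto
    thus "integrable lborel (f n)" by (simp add: set_integrable_def f_def [abs_def])
    have "integral\<^sup>L lborel (f n) = (LINT t:{0<..<1}|lborel. a n * of_real t powr (s + of_nat n - 1))"
      by (simp only: set_lebesgue_integral_def f_def [abs_def])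
    thus "integral\<^sup>L lborel (f n) = a n / (s + of_nat n)" using *(2) s by simp
    have "(\<integral>t. norm (f n t) \<partial>lborel) =
        (LINT t:{0<..<1}|lborel. norm (a n) * norm (of_real t powr (s + of_nat n - 1)))"
      unfolding set_lebesgue_integral_def f_def
      by (rule Bochner_Integration.integral_cong) (auto simp: norm_mult indicator_def)
    thus "(\<integral>t. norm (f n t) \<partial>lborel) = norm (a n) / (Re s + n)" using *(3) s by simp
  qed
  have sum_norm: "summable (\<lambda>n. \<integral>t. norm (f n t) \<partial>lborel)"
  proof (rule summable_comparison_test')
    show "summable (\<lambda>n. norm (a n) / Re s)" by (intro summable_divide summ)
    show "norm (\<integral>t. norm (f n t) \<partial>lborel) \<le> norm (a n) / Re s" for n
      unfolding nval using s by (auto intro!: divide_left_mono)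
  qed
  have sum_pt: "summable (\<lambda>n. norm (f n t))" for t
  proof (cases "t \<in> {0<..<1}")
    case True
    have "summable (\<lambda>n. norm (a n) * norm (of_real t powr (s - 1) :: complex))"
      by (intro summable_mult2 summ)
    thus ?thesis
    proof (rule summable_comparison_test')
      fix n
      have "t ^ n \<le> 1" using True by (intro power_le_one) auto
      hence "norm (a n) * t ^ n * norm (of_real t powr (s - 1) :: complex)
           \<le> norm (a n) * 1 * norm (of_real t powr (s - 1) :: complex)"
        by (intro mult_right_mono mult_left_mono) auto
      thus "norm (norm (f n t)) \<le> norm (a n) * norm (of_real t powr (s - 1) :: complex)"
        using True by (simp add: f_eq norm_mult norm_power)
    qed
  qed (auto simp: f_def)
  have "(\<lambda>n. integral\<^sup>L lborel (f n)) sums (\<integral>t. (\<Sum>n. f n t) \<partial>lborel)"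
    by (intro sums_integral int sum_norm AE_I2 sum_pt)
  also have "(\<lambda>t. \<Sum>n. f n t) = (\<lambda>t. indicator {0<..<1} t *\<^sub>R (g t * of_real t powr (s - 1)))"
  proof
    fix t :: real
    show "(\<Sum>n. f n t) = indicator {0<..<1} t *\<^sub>R (g t * of_real t powr (s - 1))"
    proof (cases "t \<in> {0<..<1}")
      case True
      have "(\<lambda>n. f n t) sums (g t * of_real t powr (s - 1))"
        using True sums_mult2[OF ser[of t], of "of_real t powr (s - 1)"] unfolding f_eq by simp
      thus ?thesis using True by (simp add: sums_iff)
    qed (auto simp: f_def)
  qed
  finally show ?thesis by (simp add: val set_lebesgue_integral_def)
qed

text \<open>
  The integrals over \<open>[1, n + 1]\<close> are entire by differentiation under the integral sign. On a disc
  on which \<open>Re s \<le> R\<close>, their distance to the full integral is at most the tail of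
  \<open>(1 + t) exp(-t) t\<^sup>R\<^sup>-\<^sup>1\<close>, uniformly in \<open>s\<close>, so the limit is entire too. The cut at 1 makes
  \<open>t\<^sup>s\<^sup>-\<^sup>1\<close> monotone in \<open>Re s\<close>.
\<close>
lemma mellin_tail_entire:
  "(\<lambda>s. LINT t:{1..}|lborel. complex_of_real (zeta_kernel t) * of_real t powr (s - 1)) holomorphic_on UNIV"
proof -
  define g where "g s t = complex_of_real (zeta_kernel t) * of_real t powr (s - 1)" for s t
  define f where "f n s = integral (cbox 1 (real n + 1)) (g s)" for n s
  have cont_kernel: "continuous_on A zeta_kernel" if "A \<subseteq> {0<..}" for A
    using continuous_on_zeta_kernel that continuous_on_subset by blast
  have cont: "continuous_on {1..b} (g s)" for b s
    unfolding g_def by (intro continuous_intros cont_kernel) (auto intro: cont_kernel)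
  have dom: "norm (g s t) \<le> (1 + 1 * t) * exp (- (1 * t)) * t powr (R - 1)"
    if "t \<ge> 1" "Re s \<le> R" for s t R
  proof -
    have "norm (g s t) \<le> (1 + t) * exp (- t) * t powr (Re s - 1)"
      unfolding g_def using that by (intro norm_mellin_zeta_kernel_le) auto
    also have "\<dots> \<le> (1 + t) * exp (- t) * t powr (R - 1)"
      using that by (intro mult_left_mono powr_mono) auto
    finally show ?thesis by simp
  qed
  \<comment> \<open>Integrability of the majorant needs \<open>R > 0\<close>, because it is inherited from the half-line
    starting at 0; this is why \<open>R\<close> is chosen as \<open>max 1 (Re s)\<close> below.\<close>
  have h_int: "set_integrable lborel {1..} (\<lambda>t. (1 + 1 * t) * exp (- (1 * t)) * t powr (R - 1))"
    if "R > 0" for R :: real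
    using integrable_mellin_bound(1)[OF that, of 1] by (rule set_integrable_subset) auto
  have g_int: "set_integrable lborel {1..} (g s)" for s
  proof (rule set_integrable_bound[OF h_int])
    show "max 1 (Re s) > 0" by simp
    show "set_borel_measurable lborel {1..} (g s)"
      unfolding set_borel_measurable_def g_def by measurable
    show "AE t in lborel. t \<in> {1..} \<longrightarrow> norm (g s t)
          \<le> norm ((1 + 1 * t) * exp (- (1 * t)) * t powr (max 1 (Re s) - 1))"
      using dom[of _ s "max 1 (Re s)"] by (intro AE_I2 impI) (simp add: abs_mult)
  qed
  show ?thesis unfolding g_def [symmetric]
  proof (rule holomorphic_uniform_sequence)
    show "f n holomorphic_on UNIV" for n
      unfolding f_def
    proof (rule leibniz_rule_holomorphic)
      show "((\<lambda>s. g s t) has_field_derivative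
              complex_of_real (zeta_kernel t) * (of_real t powr (s - 1) * Ln (of_real t))) (at s within UNIV)"
        if "t \<in> cbox 1 (real n + 1)" for s t
      proof -
        have "t \<noteq> 0" using that by auto
        thus ?thesis unfolding g_def powr_def by (auto intro!: derivative_eq_intros)
      qed
      show "g s integrable_on cbox 1 (real n + 1)" for s
        unfolding cbox_interval by (intro integrable_continuous_interval cont)
      show "continuous_on (UNIV \<times> cbox 1 (real n + 1))
              (\<lambda>(s, t). complex_of_real (zeta_kernel t) * (of_real t powr (s - 1) * Ln (of_real t)))"
      proof -
        have "continuous_on (UNIV \<times> cbox 1 (real n + 1)) (\<lambda>p::complex \<times> real. zeta_kernel (snd p))"
          by (rule continuous_on_compose2[OF continuous_on_zeta_kernel]) (auto intro!: continuous_intros)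
        thus ?thesis unfolding split_beta
          by (intro continuous_intros) auto
      qed
    qed auto
  next
    fix s0 :: complex
    define R where "R = norm s0 + 1"
    have R: "R > 0" by (simp add: R_def add_nonneg_pos)
    define h where "h t = (1 + 1 * t) * exp (- (1 * t)) * t powr (R - 1)" for t :: real
    define B where "B n = (LINT t:{1..}|lborel. h t) - (LINT t:{1..real n + 1}|lborel. h t)" for n :: nat
    have hI: "set_integrable lborel {1..} h" unfolding h_def using h_int[OF R] .
    have split: "(LINT t:{1..}|lborel. u t) = (LINT t:{1..b}|lborel. u t) + (LINT t:{b<..}|lborel. u t)"
      if "set_integrable lborel {1..} u" "b \<ge> 1" for b and u :: "real \<Rightarrow> 'b :: {banach, second_countable_topology}"
    proof -
      have eq: "{1..} = {1..b} \<union> {b<..}" using that(2) by auto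
      show ?thesis unfolding eq
        by (rule set_integral_Un) (use that in \<open>auto intro: set_integrable_subset\<close>)
    qed
    have "((\<lambda>b. LINT t:{1..b}|lborel. h t) \<longlongrightarrow> (LINT t:{1..}|lborel. h t)) at_top"
      by (intro tendsto_set_lebesgue_integral_at_top hI) auto
    moreover have "filterlim (\<lambda>n. real n + 1) at_top sequentially" by real_asymp
    ultimately have "(\<lambda>n. LINT t:{1..real n + 1}|lborel. h t) \<longlonglongrightarrow> (LINT t:{1..}|lborel. h t)"
      by (rule filterlim_compose)
    from tendsto_diff[OF tendsto_const[of "LINT t:{1..}|lborel. h t"] this]
    have B0: "B \<longlonglongrightarrow> 0" by (simp add: B_def [abs_def])
    have bound: "dist (f n s) (LINT t:{1..}|lborel. g s t) \<le> B n" if "s \<in> cball s0 1" for n s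
    proof -
      have "Re s \<le> norm s" by (rule complex_Re_le_cmod)
      also have "norm s \<le> norm s0 + 1"
        using that norm_triangle_sub[of s s0] by (simp add: dist_norm norm_minus_commute)
      finally have Rs: "Re s \<le> R" by (simp add: R_def)
      have sub: "set_integrable lborel {1..real n + 1} (g s)" "set_integrable lborel {real n + 1<..} (g s)"
          "set_integrable lborel {real n + 1<..} h"
        using g_int[of s] hI by (auto intro: set_integrable_subset)
      have "f n s = (LINT t:{1..real n + 1}|lborel. g s t)"
        unfolding f_def cbox_interval using set_borel_integral_eq_integral(2)[OF sub(1)] by simp
      hence "dist (f n s) (LINT t:{1..}|lborel. g s t) = norm (LINT t:{real n + 1<..}|lborel. g s t)"
        using split[OF g_int, of "real n + 1" s] by (simp add: dist_norm)
      also have "\<dots> \<le> (LINT t:{real n + 1<..}|lborel. norm (g s t))"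
        by (rule set_integral_norm_bound[OF sub(2)])
      also have "\<dots> \<le> (LINT t:{real n + 1<..}|lborel. h t)"
        unfolding h_def using Rs
        by (intro set_integral_mono set_integrable_norm sub sub(3)[unfolded h_def] dom) auto
      also have "\<dots> = B n"
        using split[OF hI, of "real n + 1"] by (simp add: B_def)
      finally show ?thesis .
    qed
    have "uniform_limit (cball s0 1) f (\<lambda>s. LINT t:{1..}|lborel. g s t) sequentially"
    proof (rule uniform_limitI)
      fix e :: real assume "e > 0"
      with B0 have "\<forall>\<^sub>F n in sequentially. B n < e" by (rule order_tendstoD)
      thus "\<forall>\<^sub>F n in sequentially. \<forall>s\<in>cball s0 1. dist (f n s) (LINT t:{1..}|lborel. g s t) < e"
        by eventually_elim (auto intro: order.strict_trans1[OF bound])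
    qed
    thus "\<exists>d>0. cball s0 d \<subseteq> UNIV \<and>
        uniform_limit (cball s0 d) f (\<lambda>s. LINT t:{1..}|lborel. g s t) sequentially"
      by (intro exI[of _ 1]) auto
  qed auto
qed

text \<open>
  The \<open>n\<close>-th function is \<open>1 / (\<Gamma>(s) (s + n))\<close> with the singularity at \<open>-n\<close> removed, written as
  a product so that it is visibly entire. On a disc and for large \<open>n\<close>, \<open>|s + n| \<ge> 1\<close>, hence
  these functions are bounded there by the maximum of \<open>|1/\<Gamma>|\<close>, and the Weierstrass test applies.
\<close>
lemma rGamma_partial_fractions_entire:
  fixes a :: "nat \<Rightarrow> complex"
  assumes summ: "summable (\<lambda>n. norm (a n))"
  shows "(\<lambda>s. \<Sum>n. a n * (pochhammer s n * rGamma (s + of_nat (Suc n)))) holomorphic_on UNIV"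
proof -
  define h :: "nat \<Rightarrow> complex \<Rightarrow> complex" where "h n s = pochhammer s n * rGamma (s + of_nat (Suc n))" for n s
  have h_eq: "h n s * (s + of_nat n) = rGamma s" for n s
    using pochhammer_rGamma[of s "Suc n"] by (simp add: h_def pochhammer_Suc algebra_simps)
  show ?thesis unfolding h_def [symmetric]
  proof (rule holomorphic_uniform_sequence)
    show "(\<lambda>s. \<Sum>n<N. a n * h n s) holomorphic_on UNIV" for N
      unfolding h_def pochhammer_prod by (intro holomorphic_intros)
  next
    fix s0 :: complex
    have "compact (rGamma ` cball s0 1)"
      by (intro compact_continuous_image holomorphic_on_imp_continuous_on holomorphic_rGamma) auto
    then obtain C where C: "\<And>s. s \<in> cball s0 1 \<Longrightarrow> norm (rGamma s) \<le> C"
      using compact_imp_bounded by (fastforce simp: bounded_iff)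
    obtain N :: nat where N: "real N \<ge> norm s0 + 2" using real_arch_simple by blast
    have "norm (a n * h n s) \<le> C * norm (a n)" if "n \<ge> N" "s \<in> cball s0 1" for n s
    proof -
      have "norm s \<le> norm s0 + 1"
        using that norm_triangle_sub[of s s0] by (simp add: dist_norm norm_minus_commute)
      moreover have "real n \<ge> real N" using that by simp
      moreover have "real n \<le> norm (s + of_nat n) + norm s"
        using norm_triangle_ineq4[of "s + of_nat n" s] by simp
      ultimately have "norm (s + of_nat n) \<ge> 1" using N by linarith
      hence "norm (h n s) * 1 \<le> norm (h n s) * norm (s + of_nat n)"
        by (intro mult_left_mono) auto
      also have "\<dots> = norm (rGamma s)" by (simp add: h_eq flip: norm_mult)
      also have "\<dots> \<le> C" using C that by auto
      finally have "norm (a n) * norm (h n s) \<le> norm (a n) * C" by (intro mult_left_mono) auto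
      thus ?thesis by (simp add: norm_mult mult.commute)
    qed
    hence "\<forall>\<^sub>F n in sequentially. \<forall>s\<in>cball s0 1. norm (a n * h n s) \<le> C * norm (a n)"
      using eventually_sequentially by blast
    hence "uniform_limit (cball s0 1) (\<lambda>N s. \<Sum>n<N. a n * h n s) (\<lambda>s. \<Sum>n. a n * h n s) sequentially"
      by (rule Weierstrass_m_test_ev) (intro summable_mult summ)
    thus "\<exists>d>0. cball s0 d \<subseteq> UNIV \<and>
        uniform_limit (cball s0 d) (\<lambda>N s. \<Sum>n<N. a n * h n s) (\<lambda>s. \<Sum>n. a n * h n s) sequentially"
      by (intro exI[of _ 1]) auto
  qed auto
qed

lemma mellin_zeta_kernel_entire:
  obtains G where "G holomorphic_on UNIV"
    and "\<And>s. Re s > 0 \<Longrightarrow>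
           G s = rGamma s * (LINT t:{0<..}|lborel. complex_of_real (zeta_kernel t) * of_real t powr (s - 1))"
proof -
  obtain a :: "nat \<Rightarrow> complex" where a: "summable (\<lambda>n. norm (a n))"
    "\<And>t. 0 < t \<Longrightarrow> t < 1 \<Longrightarrow> (\<lambda>n. a n * of_real t ^ n) sums of_real (zeta_kernel t)"
    by (rule zeta_kernel_power_series) blast
  define G where "G s = (\<Sum>n. a n * (pochhammer s n * rGamma (s + of_nat (Suc n)))) +
      rGamma s * (LINT t:{1..}|lborel. complex_of_real (zeta_kernel t) * of_real t powr (s - 1))" for s
  show ?thesis
  proof
    show "G holomorphic_on UNIV"
      unfolding G_def by (intro holomorphic_intros rGamma_partial_fractions_entire mellin_tail_entire a)
  next
    fix s :: complex assume s: "Re s > 0"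
    let ?g = "\<lambda>t. complex_of_real (zeta_kernel t) * of_real t powr (s - 1)"
    have "a n * (pochhammer s n * rGamma (s + of_nat (Suc n))) = rGamma s * (a n / (s + of_nat n))" for n
    proof -
      have "s + of_nat n \<noteq> 0" using s by (auto simp: complex_eq_iff)
      thus ?thesis
        using pochhammer_rGamma[of s "Suc n"] by (simp add: pochhammer_Suc)
    qed
    moreover have "(\<lambda>n. rGamma s * (a n / (s + of_nat n))) sums (rGamma s * (LINT t:{0<..<1}|lborel. ?g t))"
      by (intro sums_mult mellin_unit_interval_sums a s)
    ultimately have "G s = rGamma s * ((LINT t:{0<..<1}|lborel. ?g t) + (LINT t:{1..}|lborel. ?g t))"
      by (simp add: G_def sums_iff distrib_left)
    also have "(LINT t:{0<..<1}|lborel. ?g t) + (LINT t:{1..}|lborel. ?g t) = (LINT t:{0<..<1} \<union> {1..}|lborel. ?g t)"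
      by (intro set_integral_Un [symmetric] set_integrable_subset[OF integrable_mellin_zeta_kernel[OF s]]) auto
    also have "{0<..<1} \<union> {1..} = ({0<..} :: real set)" by auto
    finally show "G s = rGamma s * (LINT t:{0<..}|lborel. ?g t)" .
  qed
qed

section \<open>The zeta function\<close>

text \<open>
  The choice operator in the definition yields a function with the two required properties only
  if there is one; the entire function above divided by \<open>s - 1\<close> is a witness.
\<close>
lemma riemann_zeta_continuation:
  shows riemann_zeta_holomorphic: "riemann_zeta holomorphic_on (- {1})"
    and riemann_zeta_Dirichlet: "Re s > 1 \<Longrightarrow> riemann_zeta s = (\<Sum>n. 1 / of_nat (Suc n) powr s)"
proof -
  obtain G where G: "G holomorphic_on UNIV"
    "\<And>s. Re s > 0 \<Longrightarrow>
       G s = rGamma s * (LINT t:{0<..}|lborel. complex_of_real (zeta_kernel t) * of_real t powr (s - 1))"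
    by (rule mellin_zeta_kernel_entire) blast
  have "\<exists>f. f holomorphic_on (- {1}) \<and>
     (\<forall>s. Re s > 1 \<longrightarrow> f s = (\<Sum>n. 1 / of_nat (Suc n) powr s))"
  proof (intro exI[of _ "\<lambda>s. G s / (s - 1)"] conjI allI impI)
    show "(\<lambda>s. G s / (s - 1)) holomorphic_on - {1}"
      by (intro holomorphic_intros holomorphic_on_subset[OF G(1)]) auto
  next
    fix s :: complex assume s: "Re s > 1"
    have "s \<notin> \<int>\<^sub>\<le>\<^sub>0" using s by (auto elim!: nonpos_Ints_cases)
    hence "rGamma s * Gamma s = 1" by (simp add: rGamma_inverse_Gamma Gamma_eq_zero_iff)
    moreover have "s \<noteq> 1" using s by auto
    moreover have "G s = (rGamma s * Gamma s) * ((s - 1) * (\<Sum>n. 1 / of_nat (Suc n) powr s))"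
      using s by (simp only: G(2) mellin_zeta_kernel_eq_Dirichlet mult_ac)
    ultimately show "G s / (s - 1) = (\<Sum>n. 1 / of_nat (Suc n) powr s)" by simp
  qed
  from someI_ex[OF this] show "riemann_zeta holomorphic_on (- {1})"
    and "Re s > 1 \<Longrightarrow> riemann_zeta s = (\<Sum>n. 1 / of_nat (Suc n) powr s)"
    unfolding riemann_zeta_def by blast+
qed

text \<open>
  Both sides continue to \<open>\<complex> - {1}\<close>, which is connected, and agree where the Dirichlet series
  converges absolutely.
\<close>
lemma riemann_zeta_eq_mellin_zeta_kernel:
  assumes s: "Re s > 0" "s \<noteq> 1"
  shows "(s - 1) * riemann_zeta s =
           rGamma s * (LINT t:{0<..}|lborel. complex_of_real (zeta_kernel t) * of_real t powr (s - 1))"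
proof -
  obtain G where G: "G holomorphic_on UNIV"
    "\<And>s. Re s > 0 \<Longrightarrow>
       G s = rGamma s * (LINT t:{0<..}|lborel. complex_of_real (zeta_kernel t) * of_real t powr (s - 1))"
    by (rule mellin_zeta_kernel_entire) blast
  have "(s - 1) * riemann_zeta s = G s"
  proof (rule analytic_continuation_open[of "{s. Re s > 1}" "- {1}"
        "\<lambda>s. (s - 1) * riemann_zeta s" G])
    show "open {s. Re s > 1}" by (rule open_halfspace_Re_gt)
    have "2 \<in> {s. Re s > 1}" by simp
    thus "{s. Re s > 1} \<noteq> {}" by blast
    show "connected (- {1::complex})" by (intro connected_punctured_universe) auto
    show "(\<lambda>s. (s - 1) * riemann_zeta s) holomorphic_on - {1}"
      by (intro holomorphic_intros riemann_zeta_holomorphic)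
    show "G holomorphic_on - {1}" by (rule holomorphic_on_subset[OF G(1)]) auto
    fix z :: complex assume "z \<in> {s. Re s > 1}"
    hence z: "Re z > 1" by simp
    have "z \<notin> \<int>\<^sub>\<le>\<^sub>0" using z by (auto elim!: nonpos_Ints_cases)
    hence "rGamma z * Gamma z = 1" by (simp add: rGamma_inverse_Gamma Gamma_eq_zero_iff)
    moreover have "G z = (rGamma z * Gamma z) * ((z - 1) * riemann_zeta z)"
      using z by (simp only: G(2) mellin_zeta_kernel_eq_Dirichlet riemann_zeta_Dirichlet mult_ac)
    ultimately show "(z - 1) * riemann_zeta z = G z" by simp
  qed (use s in auto)
  thus ?thesis using G(2)[OF s(1)] by simp
qed

theorem theorem2p3:
  fixes s :: complex
  assumes "Re s > 0"
  shows "set_integrable lborel {0<..}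
           (\<lambda>t. complex_of_real (phi t * exp (- t)) * complex_of_real t powr (s - 1)) \<and>
         (if s = 1 then 1 else (s - 1) * riemann_zeta s) =
           1 / Gamma s *
           (LINT t:{0<..}|lborel.
              complex_of_real (phi t * exp (- t)) * complex_of_real t powr (s - 1))"
  unfolding zeta_kernel_def [symmetric]
proof
  show "set_integrable lborel {0<..} (\<lambda>t. complex_of_real (zeta_kernel t) * complex_of_real t powr (s - 1))"
    using assms by (rule integrable_mellin_zeta_kernel)
  show "(if s = 1 then 1 else (s - 1) * riemann_zeta s) =
      1 / Gamma s * (LINT t:{0<..}|lborel. complex_of_real (zeta_kernel t) * complex_of_real t powr (s - 1))"
  proof (cases "s = 1")
    case True
    have "(LINT t:{0<..}|lborel. complex_of_real (zeta_kernel t) * complex_of_real t powr (s - 1)) =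
          (LINT t:{0<..}|lborel. complex_of_real (zeta_kernel t))"
      by (rule set_lebesgue_integral_cong) (auto simp: True)
    also have "\<dots> = 1" by (simp add: set_integral_complex_of_real integral_zeta_kernel)
    finally show ?thesis by (simp add: True)
  next
    case False
    thus ?thesis
      using riemann_zeta_eq_mellin_zeta_kernel[OF assms] by (simp add: rGamma_inverse_Gamma divide_inverse)
  qed
qed

end
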